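(* Let $n\ge 2$, let $r,s$ be integers with $r\neq 0$, and put $t=s/r\in\mathbb{Q}$. The integer multiset $\{r^{[n^2-1]},s\}$ is $\mathrm{PSI}_n$ if and only if both $$(t-(n-1))^2+4(n-1)\qquad\text{and}\qquad 4t+n^2-4$$ are squares in $\mathbb{Q}$.
   Context: For a multiset $\mathcal{S}$ of $n^2$ integers, $\mathcal{M}_n(\mathcal{S})$ denotes the set of all $n\times n$ integer matrices whose $n^2$ entries, counted with multiplicity, are exactly the elements of $\mathcal{S}$. A matrix has integral spectrum if all its eigenvalues are integers. $\mathcal{S}$ is permutation-spectrally integral in dimension $n$ ($\mathrm{PSI}_n$) if every matrix in $\mathcal{M}_n(\mathcal{S})$ has integral spectrum. The notation $x^{[m]}$ means $m$ copies of $x$. A square in $\mathbb{Q}$ means the square of a rational number. *)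

theory Defs
  imports
    "HOL-Library.Multiset"
    "HOL-Computational_Algebra.Nth_Powers"
    "Jordan_Normal_Form.Spectral_Radius"
begin

definition entries_mset :: "'a mat \<Rightarrow> 'a multiset" where
  "entries_mset A =
     image_mset (\<lambda>ij. A $$ ij) (mset_set ({..<dim_row A} \<times> {..<dim_col A}))"

definition mats_with_entries :: "nat \<Rightarrow> int multiset \<Rightarrow> int mat set" where
  "mats_with_entries n S = {A \<in> carrier_mat n n. entries_mset A = S}"

(* The eigenvalues are those of the matrix over the complex numbers: over int or real, the
   non-real ones would be missed. *)
definition integral_spectrum :: "int mat \<Rightarrow> bool" where
  "integral_spectrum A \<longleftrightarrow> spectrum (map_mat complex_of_int A) \<subseteq> \<int>"

(* The notion is meant for multisets of exactly n^2 integers; for other sizes there is no matrix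
   with these entries, and the size conjunct prevents the condition from holding vacuously. *)
definition perm_spectrally_integral :: "nat \<Rightarrow> int multiset \<Rightarrow> bool" where
  "perm_spectrally_integral n S \<longleftrightarrow>
     size S = n\<^sup>2 \<and> (\<forall>A \<in> mats_with_entries n S. integral_spectrum A)"

end

theory Submission
  imports Defs
begin

text \<open>
  The matrices with these entries are \<open>r J + (s - r) E\<close>, where \<open>J\<close> is the all-ones matrix and
  \<open>E\<close> is the matrix unit at the position \<open>(i, j)\<close> of \<open>s\<close>. Such a matrix \<open>A\<close> has rank at most two:
  \<open>A v\<close> depends only on the coordinate sum \<open>\<sigma>\<close> of \<open>v\<close> and on the coordinate \<open>v\<^sub>j\<close>. Hence, for
  \<open>x \<noteq> 0\<close>, the equation \<open>A v = x v\<close> reduces to a homogeneous \<open>2 \<times> 2\<close> system for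
  \<open>(\<sigma>, v\<^sub>j)\<close>, and the nonzero eigenvalues are the nonzero roots of its determinant
  \<open>(x - n r) (x - d) - r (s - r)\<close>, where \<open>d = s - r\<close> if \<open>s\<close> lies on the diagonal and \<open>d = 0\<close>
  otherwise (\<open>eigenvalue_exceptional_entry_mat_iff\<close>).

  A monic quadratic over the integers has only integer roots exactly if its discriminant is a square
  (\<open>monic_quadratic_integral_roots_iff\<close>). So only two conditions arise, one for all diagonal
  positions and one for all off-diagonal positions; both kinds of position occur as \<open>n \<ge> 2\<close>. Dividing
  the two discriminants by \<open>r\<^sup>2\<close> gives the two expressions in \<open>t\<close>, and an integer is a
  square exactly if its quotient by \<open>r\<^sup>2\<close> is a rational square (\<open>is_square_int_iff_rat\<close>).
\<close>

definition exceptional_entry_mat :: "nat \<Rightarrow> 'a \<Rightarrow> 'a \<Rightarrow> nat \<Rightarrow> nat \<Rightarrow> 'a mat" where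
  "exceptional_entry_mat n r s i j = mat n n (\<lambda>kl. if kl = (i, j) then s else r)"

text \<open>
  Deleting one occurrence of \<open>s\<close> from the multiset of entries leaves only copies of \<open>r\<close>; this covers
  \<open>s = r\<close> as well, where the chosen position is arbitrary.
\<close>

lemma mats_with_one_exceptional_entry:
  assumes "0 < n"
  shows "mats_with_entries n (replicate_mset (n\<^sup>2 - 1) r + {#s#}) =
           {exceptional_entry_mat n r s i j | i j. i < n \<and> j < n}"
proof (intro equalityI subsetI)
  fix A assume "A \<in> mats_with_entries n (replicate_mset (n\<^sup>2 - 1) r + {#s#})"
  then have A: "A \<in> carrier_mat n n"
    and entries: "image_mset (($$) A) (mset_set ({..<n} \<times> {..<n})) = add_mset s (replicate_mset (n\<^sup>2 - 1) r)"
    by (auto simp: mats_with_entries_def entries_mset_def)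
  have "s \<in># image_mset (($$) A) (mset_set ({..<n} \<times> {..<n}))"
    unfolding entries by simp
  then obtain i j where ij: "i < n" "j < n" "A $$ (i, j) = s"
    by auto
  have "mset_set ({..<n} \<times> {..<n}) = add_mset (i, j) (mset_set ({..<n} \<times> {..<n} - {(i, j)}))"
    using ij by (subst mset_set.remove[of _ "(i, j)"]) auto
  with entries ij have "image_mset (($$) A) (mset_set ({..<n} \<times> {..<n} - {(i, j)})) = replicate_mset (n\<^sup>2 - 1) r"
    by simp
  then have "set_mset (image_mset (($$) A) (mset_set ({..<n} \<times> {..<n} - {(i, j)}))) \<subseteq> {r}"
    by (metis set_mset_replicate_mset_subset subset_singletonD empty_subsetI order_refl)
  then have "A $$ (k, l) = r" if "k < n" "l < n" "(k, l) \<noteq> (i, j)" for k l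
    using that by auto
  then have "A = exceptional_entry_mat n r s i j"
    using A ij by (intro eq_matI) (auto simp: exceptional_entry_mat_def)
  with ij show "A \<in> {exceptional_entry_mat n r s i j | i j. i < n \<and> j < n}"
    by blast
next
  fix A assume "A \<in> {exceptional_entry_mat n r s i j | i j. i < n \<and> j < n}"
  then obtain i j where ij: "i < n" "j < n" and A: "A = exceptional_entry_mat n r s i j"
    by blast
  let ?I = "{..<n} \<times> {..<n}"
  have others: "image_mset (\<lambda>kl. if kl = (i, j) then s else r) (mset_set (?I - {(i, j)})) =
      image_mset (\<lambda>_. r) (mset_set (?I - {(i, j)}))"
    by (rule image_mset_cong) (simp only: finite_cartesian_product finite_lessThan finite_Diff
        elem_mset_set Diff_iff singleton_iff if_False simp_thms)
  have "entries_mset A = image_mset (\<lambda>kl. if kl = (i, j) then s else r) (mset_set ?I)"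
    unfolding entries_mset_def A exceptional_entry_mat_def by (simp, intro image_mset_cong) (auto split: if_splits)
  also have "mset_set ?I = add_mset (i, j) (mset_set (?I - {(i, j)}))"
    using ij by (subst mset_set.remove[of _ "(i, j)"]) auto
  also have "image_mset (\<lambda>kl. if kl = (i, j) then s else r) \<dots> =
      add_mset s (image_mset (\<lambda>_. r) (mset_set (?I - {(i, j)})))"
    by (simp only: image_mset_add_mset others if_True simp_thms)
  also have "\<dots> = replicate_mset (n\<^sup>2 - 1) r + {#s#}"
    using ij by (simp add: image_mset_const_eq card_Diff_subset card_cartesian_product power2_eq_square)
  finally show "A \<in> mats_with_entries n (replicate_mset (n\<^sup>2 - 1) r + {#s#})"
    by (simp add: mats_with_entries_def A exceptional_entry_mat_def)
qed

lemma exceptional_entry_mat_mult_vec: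
  fixes r s :: "'a::comm_ring_1"
  assumes "i < n" "j < n" "v \<in> carrier_vec n" "k < n"
  shows "(exceptional_entry_mat n r s i j *\<^sub>v v) $ k =
           r * (\<Sum>l<n. v $ l) + (if k = i then (s - r) * v $ j else 0)"
proof -
  have "(exceptional_entry_mat n r s i j *\<^sub>v v) $ k = (\<Sum>l<n. (if (k, l) = (i, j) then s else r) * v $ l)"
    using assms by (auto simp: exceptional_entry_mat_def scalar_prod_def atLeast0LessThan intro!: sum.cong)
  also have "\<dots> = (\<Sum>l<n. r * v $ l + (if l = j then if k = i then (s - r) * v $ j else 0 else 0))"
    by (intro sum.cong) (auto simp: algebra_simps)
  also have "\<dots> = r * (\<Sum>l<n. v $ l) + (if k = i then (s - r) * v $ j else 0)"
    using assms by (simp add: sum.distrib sum_distrib_left)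
  finally show ?thesis .
qed

text \<open>
  With \<open>\<sigma>\<close> the coordinate sum of \<open>v\<close>, summing all coordinates of \<open>A v = x v\<close> gives
  \<open>(x - n r) \<sigma> = (s - r) v\<^sub>j\<close>, and its \<open>j\<close>-th coordinate gives \<open>(x - d) v\<^sub>j = r \<sigma>\<close>. As \<open>x \<noteq> 0\<close>,
  the vector \<open>v\<close> can be recovered from \<open>(\<sigma>, v\<^sub>j)\<close>, so the eigenvalues \<open>x \<noteq> 0\<close> are those for
  which this system has a nontrivial solution.
\<close>

lemma eigenvalue_exceptional_entry_mat_iff:
  fixes r s x :: "'a::field"
  assumes ij: "i < n" "j < n" and "r \<noteq> 0" and "x \<noteq> 0"
  defines "d \<equiv> if i = j then s - r else 0"
  shows "eigenvalue (exceptional_entry_mat n r s i j) x \<longleftrightarrow> (x - of_nat n * r) * (x - d) = r * (s - r)"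
proof
  assume "eigenvalue (exceptional_entry_mat n r s i j) x"
  then obtain v where v: "v \<in> carrier_vec n" "v \<noteq> 0\<^sub>v n"
    and eig: "exceptional_entry_mat n r s i j *\<^sub>v v = x \<cdot>\<^sub>v v"
    by (auto simp: eigenvalue_def eigenvector_def exceptional_entry_mat_def)
  define \<sigma> where "\<sigma> = (\<Sum>l<n. v $ l)"
  have comp: "x * v $ k = r * \<sigma> + (if k = i then (s - r) * v $ j else 0)" if "k < n" for k
    using exceptional_entry_mat_mult_vec[OF ij v(1) that, of r s] v that unfolding eig \<sigma>_def by simp
  have "x * \<sigma> = (\<Sum>k<n. r * \<sigma> + (if k = i then (s - r) * v $ j else 0))"
    unfolding \<sigma>_def sum_distrib_left by (intro sum.cong) (auto simp: comp \<sigma>_def sum_distrib_left)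
  then have sum_eq: "(x - of_nat n * r) * \<sigma> = (s - r) * v $ j"
    using ij by (simp add: sum.distrib algebra_simps)
  have comp_eq: "(x - d) * v $ j = r * \<sigma>"
    using comp[OF ij(2)] by (auto simp: d_def algebra_simps)
  have "\<sigma> \<noteq> 0"
  proof
    assume "\<sigma> = 0"
    then have "(s - r) * v $ j = 0"
      using sum_eq by simp
    then have "(if k = i then (s - r) * v $ j else 0) = 0" for k
      by (simp only: if_cancel)
    then have "x * v $ k = 0" if "k < n" for k
      using comp[OF that] \<open>\<sigma> = 0\<close> by (metis add_0 mult_zero_right)
    then have "v $ k = 0" if "k < n" for k
      using that \<open>x \<noteq> 0\<close> by simp
    with v show False
      by (metis eq_vecI carrier_vecD index_zero_vec)
  qed
  have "((x - of_nat n * r) * (x - d)) * \<sigma> = (s - r) * ((x - d) * v $ j)"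
    using sum_eq by (metis mult.assoc mult.commute)
  also have "\<dots> = (r * (s - r)) * \<sigma>"
    unfolding comp_eq by simp
  finally show "(x - of_nat n * r) * (x - d) = r * (s - r)"
    using \<open>\<sigma> \<noteq> 0\<close> by simp
next
  assume char: "(x - of_nat n * r) * (x - d) = r * (s - r)"
  \<comment> \<open>The second equation of the system is solved by \<open>\<sigma> = x - d\<close> and \<open>v\<^sub>j = r\<close>, and
    \<open>A v = x v\<close> then determines all coordinates of \<open>v\<close>; as \<open>v\<^sub>j = r \<noteq> 0\<close>, it is not the zero vector.\<close>
  define v where "v = vec n (\<lambda>k. (r * (x - d) + (if k = i then (s - r) * r else 0)) / x)"
  have v: "v \<in> carrier_vec n"
    by (simp add: v_def)
  have vj: "v $ j = r"
    using ij \<open>x \<noteq> 0\<close> by (auto simp: v_def d_def field_simps)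
  have "(\<Sum>l<n. v $ l) = (of_nat n * r * (x - d) + (s - r) * r) / x"
    using ij by (simp add: v_def sum_divide_distrib[symmetric] sum.distrib mult.assoc)
  also have "\<dots> = x - d"
    using char \<open>x \<noteq> 0\<close> by (simp add: field_simps)
  finally have sum_v: "(\<Sum>l<n. v $ l) = x - d" .
  have "x * v $ k = r * (x - d) + (if k = i then (s - r) * r else 0)" if "k < n" for k
    using that \<open>x \<noteq> 0\<close> by (simp add: v_def)
  then have "(exceptional_entry_mat n r s i j *\<^sub>v v) $ k = x * v $ k" if "k < n" for k
    using that by (simp only: exceptional_entry_mat_mult_vec[OF ij v that] sum_v vj)
  then have "exceptional_entry_mat n r s i j *\<^sub>v v = x \<cdot>\<^sub>v v"
    using v by (intro eq_vecI) (simp_all add: exceptional_entry_mat_def)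
  moreover have "v \<noteq> 0\<^sub>v n"
    using vj ij \<open>r \<noteq> 0\<close> by auto
  ultimately show "eigenvalue (exceptional_entry_mat n r s i j) x"
    using v by (auto simp: eigenvalue_def eigenvector_def exceptional_entry_mat_def)
qed

text \<open>
  An integer that is the square of a rational number \<open>a / b\<close> in lowest terms is the square of an
  integer, because \<open>b\<^sup>2\<close> divides \<open>a\<^sup>2\<close> and so \<open>b = 1\<close>.
\<close>

lemma is_square_int_iff_rat:
  fixes D r :: int
  assumes "r \<noteq> 0"
  shows "is_square D \<longleftrightarrow> is_square (of_int D / of_int r ^ 2 :: rat)"
proof
  assume "is_square D"
  then obtain e where "D = e\<^sup>2"
    by (auto elim: is_nth_powerE)
  then have "of_int D / of_int r ^ 2 = (of_int e / of_int r :: rat)\<^sup>2"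
    by (simp add: power_divide)
  then show "is_square (of_int D / of_int r ^ 2 :: rat)"
    by (metis is_nth_power_nth_power)
next
  assume "is_square (of_int D / of_int r ^ 2 :: rat)"
  then obtain q :: rat where "of_int D / of_int r ^ 2 = q\<^sup>2"
    by (auto elim: is_nth_powerE)
  then have q: "of_int D = (q * of_int r)\<^sup>2"
    using assms by (simp add: field_simps power_mult_distrib)
  obtain a b where ab: "q * of_int r = of_int a / of_int b" "b > 0" "coprime a b"
    using quotient_of_div[of "q * of_int r"] quotient_of_denom_pos quotient_of_coprime
    by (metis surj_pair)
  have "(of_int (D * b\<^sup>2) :: rat) = of_int (a\<^sup>2)"
    using q ab by (simp add: field_simps power_divide)
  then have "D * b\<^sup>2 = a\<^sup>2"
    by (simp only: of_int_eq_iff)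
  then have "b dvd a"
    by (metis dvd_triv_right pow_divides_pow_iff zero_less_numeral)
  with ab have "b = 1"
    by (metis coprime_common_divisor dvd_refl abs_of_pos zdvd1_eq)
  with \<open>D * b\<^sup>2 = a\<^sup>2\<close> show "is_square D"
    by simp
qed

text \<open>
  The discriminant is the square of the difference of the two roots. Conversely, if it equals
  \<open>e\<^sup>2\<close>, then \<open>e\<close> has the parity of \<open>b\<close>, so that the roots \<open>(b \<plusminus> e) / 2\<close> are integers.
\<close>

lemma monic_quadratic_integral_roots_iff:
  fixes b c :: int
  shows "(\<forall>z::complex. z\<^sup>2 - of_int b * z + of_int c = 0 \<longrightarrow> z \<in> \<int>) \<longleftrightarrow> is_square (b\<^sup>2 - 4 * c)"
proof
  assume roots: "\<forall>z::complex. z\<^sup>2 - of_int b * z + of_int c = 0 \<longrightarrow> z \<in> \<int>"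
  define w where "w = csqrt (of_int (b\<^sup>2 - 4 * c))"
  define z where "z = (of_int b + w) / 2"
  have w: "w\<^sup>2 = of_int b ^ 2 - 4 * of_int c"
    by (simp add: w_def)
  have "4 * (z\<^sup>2 - of_int b * z + of_int c) = w\<^sup>2 - of_int b ^ 2 + 4 * of_int c"
    by (simp add: z_def field_simps power2_eq_square)
  also have "\<dots> = 0"
    unfolding w by simp
  finally have "z\<^sup>2 - of_int b * z + of_int c = 0"
    by (simp only: mult_eq_0_iff) simp
  then have "z \<in> \<int>"
    using roots by blast
  then obtain m where "z = of_int m"
    by (auto elim: Ints_cases)
  then have "w = of_int (2 * m - b)"
    by (simp add: z_def field_simps)
  with w have "of_int (b\<^sup>2 - 4 * c) = (of_int ((2 * m - b)\<^sup>2) :: complex)"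
    by simp
  then have "b\<^sup>2 - 4 * c = (2 * m - b)\<^sup>2"
    by (simp only: of_int_eq_iff)
  then show "is_square (b\<^sup>2 - 4 * c)"
    by simp
next
  assume "is_square (b\<^sup>2 - 4 * c)"
  then obtain e where e: "b\<^sup>2 - 4 * c = e\<^sup>2"
    by (auto elim: is_nth_powerE)
  have "even (b\<^sup>2 - 4 * c) \<longleftrightarrow> even b"
    by simp
  then have "even (b + e)"
    unfolding e by simp
  then obtain m where m: "b + e = 2 * m"
    by blast
  then have be: "b = m + (m - e)"
    by simp
  have "4 * c = b\<^sup>2 - e\<^sup>2"
    using e by simp
  also have "\<dots> = 4 * (m * (m - e))"
    unfolding be by (simp add: algebra_simps power2_eq_square)
  finally have c: "c = m * (m - e)"
    by simp
  show "\<forall>z::complex. z\<^sup>2 - of_int b * z + of_int c = 0 \<longrightarrow> z \<in> \<int>"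
  proof (intro allI impI)
    fix z :: complex assume "z\<^sup>2 - of_int b * z + of_int c = 0"
    then have "(z - of_int m) * (z - of_int (m - e)) = 0"
      unfolding c by (subst (asm) be) (simp add: algebra_simps power2_eq_square)
    then have "z = of_int m \<or> z = of_int (m - e)"
      by simp
    then show "z \<in> \<int>"
      by (metis Ints_of_int)
  qed
qed

text \<open>
  The root \<open>0\<close> of the quadratic and the eigenvalue \<open>0\<close> of the matrix need not correspond to each other,
  but both are integers, so that integrality can be tested on the nonzero values alone. The
  discriminant of \<open>(x - n r) (x - d) - r (s - r)\<close> is \<open>(n r - d)\<^sup>2 + 4 r (s - r)\<close>.
\<close>

lemma integral_spectrum_exceptional_entry_mat_iff:
  fixes r s :: int
  assumes ij: "i < n" "j < n" and "r \<noteq> 0"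
  defines "d \<equiv> if i = j then s - r else 0"
  shows "integral_spectrum (exceptional_entry_mat n r s i j) \<longleftrightarrow>
           is_square ((int n * r - d)\<^sup>2 + 4 * r * (s - r))"
proof -
  have map: "map_mat complex_of_int (exceptional_entry_mat n r s i j) =
      exceptional_entry_mat n (complex_of_int r) (complex_of_int s) i j"
    by (intro eq_matI) (auto simp: exceptional_entry_mat_def)
  have eig: "eigenvalue (map_mat complex_of_int (exceptional_entry_mat n r s i j)) z \<longleftrightarrow>
      z\<^sup>2 - of_int (int n * r + d) * z + of_int (int n * r * d - r * (s - r)) = 0" if "z \<noteq> 0" for z
    using eigenvalue_exceptional_entry_mat_iff[OF ij, of "complex_of_int r" z "complex_of_int s"] that \<open>r \<noteq> 0\<close>
    unfolding map by (auto simp: d_def algebra_simps power2_eq_square)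
  have nonzero: "(\<forall>z. z \<noteq> 0 \<longrightarrow> P z \<longrightarrow> z \<in> \<int>) \<longleftrightarrow> (\<forall>z. P z \<longrightarrow> z \<in> \<int>)" for P :: "complex \<Rightarrow> bool"
    by (rule all_cong1) auto
  have "integral_spectrum (exceptional_entry_mat n r s i j) \<longleftrightarrow>
      (\<forall>z. eigenvalue (map_mat complex_of_int (exceptional_entry_mat n r s i j)) z \<longrightarrow> z \<in> \<int>)"
    by (simp only: integral_spectrum_def spectrum_def subset_iff mem_Collect_eq)
  also have "\<dots> \<longleftrightarrow> (\<forall>z. z \<noteq> 0 \<longrightarrow> eigenvalue (map_mat complex_of_int (exceptional_entry_mat n r s i j)) z \<longrightarrow> z \<in> \<int>)"
    by (rule nonzero[symmetric])
  also have "\<dots> \<longleftrightarrow> (\<forall>z::complex. z \<noteq> 0 \<longrightarrow> z\<^sup>2 - of_int (int n * r + d) * z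
      + of_int (int n * r * d - r * (s - r)) = 0 \<longrightarrow> z \<in> \<int>)"
    by (intro all_cong1 imp_cong refl eig)
  also have "\<dots> \<longleftrightarrow> (\<forall>z::complex. z\<^sup>2 - of_int (int n * r + d) * z
      + of_int (int n * r * d - r * (s - r)) = 0 \<longrightarrow> z \<in> \<int>)"
    by (rule nonzero)
  also have "\<dots> \<longleftrightarrow> is_square ((int n * r + d)\<^sup>2 - 4 * (int n * r * d - r * (s - r)))"
    by (rule monic_quadratic_integral_roots_iff)
  also have "(int n * r + d)\<^sup>2 - 4 * (int n * r * d - r * (s - r)) = (int n * r - d)\<^sup>2 + 4 * r * (s - r)"
    by (simp add: algebra_simps power2_eq_square)
  finally show ?thesis .
qed

theorem theorem5p2:
  fixes n :: nat and r s :: int and t :: rat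
  assumes "n \<ge> 2" and "r \<noteq> 0" and "t = of_int s / of_int r"
  shows "perm_spectrally_integral n (replicate_mset (n\<^sup>2 - 1) r + {#s#}) \<longleftrightarrow>
           is_square ((t - (of_nat n - 1))\<^sup>2 + 4 * (of_nat n - 1)) \<and>
           is_square (4 * t + (of_nat n)\<^sup>2 - 4)"
proof -
  let ?on = "(int n * r - (s - r))\<^sup>2 + 4 * r * (s - r)"
  let ?off = "(int n * r)\<^sup>2 + 4 * r * (s - r)"
  have spec: "integral_spectrum (exceptional_entry_mat n r s i j) \<longleftrightarrow> (if i = j then is_square ?on else is_square ?off)"
    if "i < n" "j < n" for i j
    using integral_spectrum_exceptional_entry_mat_iff[OF that \<open>r \<noteq> 0\<close>, of s] by simp
  have "0 < n" "1 < n"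
    using \<open>n \<ge> 2\<close> by auto
  have positions: "(\<forall>i<n. \<forall>j<n. if i = j then P else Q) \<longleftrightarrow> P \<and> Q" for P Q
    using \<open>0 < n\<close> \<open>1 < n\<close> by (metis zero_neq_one)
  have "size (replicate_mset (n\<^sup>2 - 1) r + {#s#}) = n\<^sup>2"
    using \<open>0 < n\<close> by simp
  then have "perm_spectrally_integral n (replicate_mset (n\<^sup>2 - 1) r + {#s#}) \<longleftrightarrow>
      (\<forall>i<n. \<forall>j<n. integral_spectrum (exceptional_entry_mat n r s i j))"
    unfolding perm_spectrally_integral_def mats_with_one_exceptional_entry[OF \<open>0 < n\<close>] by auto
  also have "\<dots> \<longleftrightarrow> (\<forall>i<n. \<forall>j<n. if i = j then is_square ?on else is_square ?off)"
    by (simp only: spec cong: imp_cong)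
  also have "\<dots> \<longleftrightarrow> is_square ?on \<and> is_square ?off"
    by (rule positions)
  also have "is_square ?on \<longleftrightarrow> is_square (of_int ?on / of_int r ^ 2 :: rat)"
    by (rule is_square_int_iff_rat[OF \<open>r \<noteq> 0\<close>])
  also have "of_int ?on / of_int r ^ 2 = (t - (of_nat n - 1))\<^sup>2 + 4 * (of_nat n - 1)"
    using \<open>r \<noteq> 0\<close> unfolding assms(3) by (simp add: field_simps power2_eq_square)
  also have "is_square ?off \<longleftrightarrow> is_square (of_int ?off / of_int r ^ 2 :: rat)"
    by (rule is_square_int_iff_rat[OF \<open>r \<noteq> 0\<close>])
  also have "of_int ?off / of_int r ^ 2 = 4 * t + (of_nat n)\<^sup>2 - 4"
    using \<open>r \<noteq> 0\<close> unfolding assms(3) by (simp add: field_simps power2_eq_square)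
  finally show ?thesis .
qed

end
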